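(* Let $i\ge 1$ and $\ell\ge 1$ be integers, let $\delta>0$, and use the notation and standing assumptions of the context. (i) (Iterated Arnoldi-Tikhonov; here $n_1=n_2=n$.) Assume that $\tilde{\mathcal R}_\ell T_n x_n^\dagger=\tilde T_n^{(\ell)}x_n^\dagger$ and that $\delta\le \|\tilde{\mathcal R}_\ell y_n^\delta\|_2=\|I_{\ell,\ell+1}\tilde W_{\ell+1}^*\tilde y_{\ell+1}^\delta\|_2$. Let $\tilde\alpha>0$ be the unique solution of $$\tilde\alpha^{2i+1}(\tilde{\hat y}_{\ell+1}^\delta)^*(\tilde\Sigma_{\ell+1,\ell}\tilde\Sigma_{\ell+1,\ell}^*+\tilde\alpha I_{\ell+1})^{-2i-1}\tilde{\hat y}_{\ell+1}^\delta=\delta^2 .$$ Then for all $\alpha'\ge\tilde\alpha$, $$\|x_n^\dagger-\tilde x_{\tilde\alpha,n,i}^{\delta,\ell}\|_2\le\|x_n^\dagger-\tilde x_{\alpha',n,i}^{\delta,\ell}\|_2 .$$ (ii) (Iterated Golub-Kahan-Tikhonov.) Assume that $\mathcal R_\ell T_n x_n^\dagger=T_n^{(\ell)}x_n^\dagger$ and that $\delta\le \|\mathcal R_\ell y_n^\delta\|_2=\|I_{\ell,\ell+1}W_{\ell+1}^*y_{\ell+1}^\delta\|_2$. Let $\alpha>0$ be the unique solution of $$\alpha^{2i+1}(\hat y_{\ell+1}^\delta)^*(\Sigma_{\ell+1,\ell}\Sigma_{\ell+1,\ell}^*+\alpha I_{\ell+1})^{-2i-1}\hat y_{\ell+1}^\delta=\delta^2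 .$$ Then for all $\alpha''\ge\alpha$, $$\|x_n^\dagger-x_{\alpha,n,i}^{\delta,\ell}\|_2\le\|x_n^\dagger-x_{\alpha'',n,i}^{\delta,\ell}\|_2 .$$
   Context: $T_n\in\mathbb R^{n_1\times n_2}$ is a matrix, $y_n\in\mathbb R^{n_1}$ lies in the range of $T_n$, and $x_n^\dagger=T_n^\dagger y_n\in\mathbb{R}^{n_2}$ is the minimal-norm solution of $T_nx_n=y_n$ (with $T_n^\dagger$ the Moore-Penrose pseudoinverse), so $T_nx_n^\dagger=y_n$. The available data $y_n^\delta\in\mathbb R^{n_1}$, $y_n^\delta\ne0$, satisfy $\|y_n-y_n^\delta\|_2\le\delta$. $^*$ denotes transposition, $\|\cdot\|_2$ the Euclidean norm, $I_k$ the identity matrix of order $k$, and $I_{\ell,\ell+1}=\begin{bmatrix}I_\ell&0\\0&0\end{bmatrix}\in\mathbb R^{(\ell+1)\times(\ell+1)}$. Arnoldi quantities ($n_1=n_2=n$). $\ell$ steps of the Arnoldi process applied to $T_n$ with initial vector $y_n^\delta$ give $T_nV_{n,\ell}=V_{n,\ell+1}H_{\ell+1,\ell}$, where the columns of $V_{n,\ell+1}\in\mathbb R^{n\times(\ell+1)}$ form an orthonormal basis of $\mathrm{span}\{y_n^\delta,T_ny_n^\delta,\dots,T_n^\ell y_n^\delta\}$ with first column $y_n^\delta/\|y_n^\delta\|_2$, $V_{n,\ell}$ consists of its first $\ell$ columns, and $H_{\ell+1,\ell}\in\mathbb R^{(\ell+1)\times\ell}$ is upper Hessenberg. All subdiagonal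 entries of $H_{\ell+1,\ell}$ are assumed nonzero, so it has rank $\ell$. Define $\tilde T_n^{(\ell)}=V_{n,\ell+1}H_{\ell+1,\ell}V_{n,\ell}^*$. Let $H_{\ell+1,\ell}=\tilde W_{\ell+1}\tilde\Sigma_{\ell+1,\ell}\tilde S_\ell^*$ be a singular value decomposition with $\tilde W_{\ell+1}\in\mathbb R^{(\ell+1)\times(\ell+1)}$, $\tilde S_\ell\in\mathbb R^{\ell\times\ell}$ orthogonal and $\tilde\Sigma_{\ell+1,\ell}\in\mathbb R^{(\ell+1)\times\ell}$ diagonal with nonincreasing diagonal entries. Let $\tilde y_{\ell+1}^\delta=V_{n,\ell+1}^*y_n^\delta$ and $\tilde{\hat y}_{\ell+1}^\delta=I_{\ell,\ell+1}\tilde W_{\ell+1}^*\tilde y_{\ell+1}^\delta$, and assume that $\tilde{\hat y}_{\ell+1}^\delta\neq 0$. $\tilde{\mathcal R}_\ell=V_{n,\ell+1}\tilde W_{\ell+1}I_{\ell,\ell+1}\tilde W_{\ell+1}^*V_{n,\ell+1}^*$ is the orthogonal projector onto the range of $\tilde T_n^{(\ell)}$. For $\beta>0$, $$\tilde x_{\beta,n,i}^{\delta,\ell}=\sum_{k=1}^i\beta^{k-1}\bigl(\tilde T_n^{(\ell)*}\tilde T_n^{(\ell)}+\beta I_n\bigr)^{-k}\tilde T_n^{(\ell)*}y_n^\delta .$$ Golub-Kahan quantities. $\ell$ steps of Golub-Kahan bidiagonalization applied to $T_n$ with initial vector $y_n^\delta$ give $T_nV_\ell=U_{\ell+1}B_{\ell+1,\ell}$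 and $T_n^*U_\ell=V_\ell B_{\ell,\ell}^*$, where $U_{\ell+1}\in\mathbb R^{n_1\times(\ell+1)}$ and $V_\ell\in\mathbb R^{n_2\times\ell}$ have orthonormal columns, the first column of $U_{\ell+1}$ is $y_n^\delta/\|y_n^\delta\|_2$, $U_\ell$ consists of the first $\ell$ columns of $U_{\ell+1}$, $B_{\ell+1,\ell}\in\mathbb R^{(\ell+1)\times\ell}$ is lower bidiagonal, and $B_{\ell,\ell}$ consists of its first $\ell$ rows. All diagonal and subdiagonal entries of $B_{\ell+1,\ell}$ are assumed nonzero, so it has rank $\ell$. Define $T_n^{(\ell)}=U_{\ell+1}B_{\ell+1,\ell}V_\ell^*$. Let $B_{\ell+1,\ell}=W_{\ell+1}\Sigma_{\ell+1,\ell}S_\ell^*$ be a singular value decomposition with $W_{\ell+1}\in\mathbb R^{(\ell+1)\times(\ell+1)}$, $S_\ell\in\mathbb R^{\ell\times\ell}$ orthogonal and $\Sigma_{\ell+1,\ell}\in\mathbb R^{(\ell+1)\times\ell}$ diagonal with nonincreasing diagonal entries. Let $y_{\ell+1}^\delta=U_{\ell+1}^*y_n^\delta$ and $\hat y_{\ell+1}^\delta=I_{\ell,\ell+1}W_{\ell+1}^*y_{\ell+1}^\delta$, and assume that $\hat y_{\ell+1}^\delta\neq0$. $\mathcal R_\ell=U_{\ell+1}W_{\ell+1}I_{\ell,\ell+1}W_{\ell+1}^*U_{\ell+1}^*$ is the orthogonal projector onto the range of $T_n^{(\ell)}$. For $\beta>0$, $$x_{\beta,n,i}^{\delta,\ell}=\sum_{k=1}^i\beta^{k-1}\bigl(T_n^{(\ell)*}T_n^{(\ell)}+\beta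 I_{n_2}\bigr)^{-k}T_n^{(\ell)*}y_n^\delta .$$ *)

theory Defs
  imports Complex_Main
    "Jordan_Normal_Form.Gauss_Jordan_Elimination"
    "Jordan_Normal_Form.VS_Connect"
begin

definition norm2 :: "real vec \<Rightarrow> real" where
  "norm2 v = sqrt (v \<bullet> v)"

text \<open>\<open>X\<close> is the Moore-Penrose pseudoinverse of \<open>A\<close>, given by the four Penrose equations,
  which determine \<open>X\<close> uniquely.\<close>

definition moore_penrose :: "real mat \<Rightarrow> real mat \<Rightarrow> bool" where
  "moore_penrose A X \<longleftrightarrow>
     X \<in> carrier_mat (dim_col A) (dim_row A) \<and>
     A * X * A = A \<and> X * A * X = X \<and>
     (A * X)\<^sup>T = A * X \<and> (X * A)\<^sup>T = X * A"

text \<open>The library's \<open>orthogonal_mat\<close> only asks for pairwise orthogonal nonzero columns,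
  so it is not what is needed here. For square \<open>A\<close> the following says that \<open>A\<close> is orthogonal.\<close>

definition orthonormal_cols :: "real mat \<Rightarrow> bool" where
  "orthonormal_cols A \<longleftrightarrow> A\<^sup>T * A = 1\<^sub>m (dim_col A)"

definition is_svd :: "real mat \<Rightarrow> real mat \<Rightarrow> real mat \<Rightarrow> real mat \<Rightarrow> bool" where
  "is_svd A W \<Sigma> S \<longleftrightarrow>
     W \<in> carrier_mat (dim_row A) (dim_row A) \<and> orthonormal_cols W \<and>
     S \<in> carrier_mat (dim_col A) (dim_col A) \<and> orthonormal_cols S \<and>
     \<Sigma> \<in> carrier_mat (dim_row A) (dim_col A) \<and> diagonal_mat \<Sigma> \<and>
     (\<forall>j < min (dim_row A) (dim_col A). 0 \<le> \<Sigma> $$ (j, j)) \<and>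
     (\<forall>j k. j \<le> k \<and> k < min (dim_row A) (dim_col A) \<longrightarrow> \<Sigma> $$ (k, k) \<le> \<Sigma> $$ (j, j)) \<and>
     A = W * \<Sigma> * S\<^sup>T"

definition first_cols :: "nat \<Rightarrow> real mat \<Rightarrow> real mat" where
  "first_cols k A = mat (dim_row A) k (\<lambda>p. A $$ p)"

definition first_rows :: "nat \<Rightarrow> real mat \<Rightarrow> real mat" where
  "first_rows k A = mat k (dim_col A) (\<lambda>p. A $$ p)"

definition upper_hessenberg :: "real mat \<Rightarrow> bool" where
  "upper_hessenberg A \<longleftrightarrow> (\<forall>i < dim_row A. \<forall>j < dim_col A. j + 1 < i \<longrightarrow> A $$ (i, j) = 0)"

definition lower_bidiagonal :: "real mat \<Rightarrow> bool" where
  "lower_bidiagonal A \<longleftrightarrow>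
     (\<forall>i < dim_row A. \<forall>j < dim_col A. i \<noteq> j \<and> i \<noteq> j + 1 \<longrightarrow> A $$ (i, j) = 0)"

definition krylov_mat :: "nat \<Rightarrow> nat \<Rightarrow> real mat \<Rightarrow> real vec \<Rightarrow> real mat" where
  "krylov_mat n m A b = mat_of_cols n (map (\<lambda>j. (A ^\<^sub>m j) *\<^sub>v b) [0..<m])"

definition arnoldi :: "nat \<Rightarrow> nat \<Rightarrow> real mat \<Rightarrow> real vec \<Rightarrow> real mat \<Rightarrow> real mat \<Rightarrow> bool" where
  "arnoldi n l A b V H \<longleftrightarrow>
     V \<in> carrier_mat n (l + 1) \<and> H \<in> carrier_mat (l + 1) l \<and>
     orthonormal_cols V \<and>
     vec_space.col_space n V = vec_space.col_space n (krylov_mat n (l + 1) A b) \<and>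
     col V 0 = (1 / norm2 b) \<cdot>\<^sub>v b \<and>
     A * first_cols l V = V * H \<and>
     upper_hessenberg H \<and> (\<forall>j < l. H $$ (j + 1, j) \<noteq> 0)"

definition golub_kahan ::
  "nat \<Rightarrow> nat \<Rightarrow> nat \<Rightarrow> real mat \<Rightarrow> real vec \<Rightarrow> real mat \<Rightarrow> real mat \<Rightarrow> real mat \<Rightarrow> bool" where
  "golub_kahan n1 n2 l A b U V B \<longleftrightarrow>
     U \<in> carrier_mat n1 (l + 1) \<and> V \<in> carrier_mat n2 l \<and> B \<in> carrier_mat (l + 1) l \<and>
     orthonormal_cols U \<and> orthonormal_cols V \<and>
     col U 0 = (1 / norm2 b) \<cdot>\<^sub>v b \<and>
     A * V = U * B \<and> A\<^sup>T * first_cols l U = V * (first_rows l B)\<^sup>T \<and>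
     lower_bidiagonal B \<and> (\<forall>j < l. B $$ (j, j) \<noteq> 0 \<and> B $$ (j + 1, j) \<noteq> 0)"

text \<open>The matrix $I_{\ell,\ell+1}$ of order $\ell+1$.\<close>

definition trunc_id :: "nat \<Rightarrow> real mat" where
  "trunc_id l = four_block_mat (1\<^sub>m l) (0\<^sub>m l 1) (0\<^sub>m 1 l) (0\<^sub>m 1 1)"

text \<open>\<open>neg_pow A k\<close> is $A^{-k}$; it is meant for invertible \<open>A\<close>, since otherwise
  \<open>mat_inverse A\<close> is \<open>None\<close>.\<close>

definition neg_pow :: "real mat \<Rightarrow> nat \<Rightarrow> real mat" where
  "neg_pow A k = (the (mat_inverse A)) ^\<^sub>m k"

definition iter_tikhonov :: "nat \<Rightarrow> real mat \<Rightarrow> real vec \<Rightarrow> real \<Rightarrow> real vec" where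
  "iter_tikhonov i A b \<beta> =
     finsum_vec TYPE(real) (dim_col A)
       (\<lambda>k. \<beta> ^ (k - 1) \<cdot>\<^sub>v
          (neg_pow (A\<^sup>T * A + \<beta> \<cdot>\<^sub>m 1\<^sub>m (dim_col A)) k *\<^sub>v (A\<^sup>T *\<^sub>v b)))
       {1..i}"

text \<open>Below, \<open>Q\<close> stands for the matrix with \<open>l + 1\<close> orthonormal columns produced by the Arnoldi
  or Golub-Kahan process, and \<open>W\<close> for the left factor of the singular value decomposition of
  the projected matrix.\<close>

definition range_proj :: "nat \<Rightarrow> real mat \<Rightarrow> real mat \<Rightarrow> real mat" where
  "range_proj l Q W = Q * W * trunc_id l * W\<^sup>T * Q\<^sup>T"

definition trunc_data :: "nat \<Rightarrow> real mat \<Rightarrow> real mat \<Rightarrow> real vec \<Rightarrow> real vec" where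
  "trunc_data l Q W b = trunc_id l *\<^sub>v (W\<^sup>T *\<^sub>v (Q\<^sup>T *\<^sub>v b))"

definition param_eq :: "nat \<Rightarrow> real mat \<Rightarrow> real vec \<Rightarrow> real \<Rightarrow> real \<Rightarrow> bool" where
  "param_eq i \<Sigma> z \<delta> a \<longleftrightarrow>
     a ^ (2 * i + 1) *
       (z \<bullet> (neg_pow (\<Sigma> * \<Sigma>\<^sup>T + a \<cdot>\<^sub>m 1\<^sub>m (dim_row \<Sigma>)) (2 * i + 1) *\<^sub>v z)) = \<delta>\<^sup>2"

end

theory Submission
  imports Defs "HOL-Analysis.L2_Norm"
begin

text \<open>Both processes give a projected matrix \<open>A = Q H P\<^sup>T\<close> where \<open>Q\<close>, \<open>P\<close> have orthonormal columns
  and \<open>H\<close> is upper Hessenberg. Let \<open>H = W \<Sigma> S\<^sup>T\<close>, \<open>U = Q W\<close> and \<open>G = P S\<close>, so that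
  \<open>A = U \<Sigma> G\<^sup>T\<close>, with positive singular values \<open>s j\<close> because a Hessenberg matrix with nonzero
  subdiagonal is injective. In the basis \<open>G\<close> the iterated Tikhonov solution has coefficients
  \<open>(1 - (\<beta> / ((s j)\<^sup>2 + \<beta>)) ^ i) / s j * u j\<close> with \<open>u = U\<^sup>T yd\<close>, and the hypothesis
  \<open>R T x = A x\<close> says
  that \<open>x\<close> has coefficients \<open>v j / s j\<close> with \<open>v = U\<^sup>T y\<close>. The component of the error orthogonal to
  the range of \<open>G\<close> does not depend on \<open>\<beta>\<close>, and the derivative of the remaining part is nonnegative
  for \<open>\<beta> \<ge> \<alpha>\<close>, by Cauchy-Schwarz and the discrepancy equation for \<open>\<alpha>\<close>.\<close>

section \<open>Filter factors and their weighted sums\<close>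

lemma filter_strict_mono:
  fixes s a b :: real
  assumes "0 < s" "0 \<le> a" "a < b"
  shows "a / (s + a) < b / (s + b)"
  using assms by (simp add: divide_simps algebra_simps)

lemma filter_sum_mono:
  fixes s z :: "nat \<Rightarrow> real"
  assumes s: "\<And>j. j < l \<Longrightarrow> 0 < s j" and "0 \<le> a" "a \<le> b"
  shows "(\<Sum>j<l. (a / (s j + a)) ^ p * (z j)\<^sup>2) \<le> (\<Sum>j<l. (b / (s j + b)) ^ p * (z j)\<^sup>2)"
proof (rule sum_mono)
  fix j assume j: "j \<in> {..<l}"
  then have "a / (s j + a) \<le> b / (s j + b)"
    using filter_strict_mono[of "s j" a b] s[of j] assms by (cases "a = b") auto
  then show "(a / (s j + a)) ^ p * (z j)\<^sup>2 \<le> (b / (s j + b)) ^ p * (z j)\<^sup>2"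
    using s[of j] assms(2) j
    by (intro mult_right_mono power_mono divide_nonneg_nonneg add_nonneg_nonneg) (auto simp: less_imp_le)
qed

text \<open>One index with \<open>z j \<noteq> 0\<close> already makes the whole sum strict;
  \<open>0 < p\<close> keeps the powers from collapsing to the constant 1.\<close>

lemma filter_sum_strict_mono:
  fixes s z :: "nat \<Rightarrow> real"
  assumes s: "\<And>j. j < l \<Longrightarrow> 0 < s j" and z: "\<exists>j<l. z j \<noteq> 0"
    and "0 \<le> a" "a < b" "0 < p"
  shows "(\<Sum>j<l. (a / (s j + a)) ^ p * (z j)\<^sup>2) < (\<Sum>j<l. (b / (s j + b)) ^ p * (z j)\<^sup>2)"
proof (rule sum_strict_mono_ex1)
  have lt: "(a / (s j + a)) ^ p < (b / (s j + b)) ^ p" if "j < l" for j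
    using filter_strict_mono[of "s j" a b] s[OF that] assms by (intro power_strict_mono) auto
  show "\<forall>j\<in>{..<l}. (a / (s j + a)) ^ p * (z j)\<^sup>2 \<le> (b / (s j + b)) ^ p * (z j)\<^sup>2"
    using lt by (auto intro!: mult_right_mono[OF less_imp_le])
  obtain j where "j < l" "z j \<noteq> 0" using z by blast
  then show "\<exists>j\<in>{..<l}. (a / (s j + a)) ^ p * (z j)\<^sup>2 < (b / (s j + b)) ^ p * (z j)\<^sup>2"
    using lt by (intro bexI[of _ j]) (auto intro: mult_strict_right_mono)
qed simp

text \<open>The sum is continuous and strictly increasing in \<open>a\<close>, vanishes at 0 and
  tends to the sum of the squares of \<open>z\<close> at infinity. The intermediate value theorem
  gives a root for \<open>d\<close> strictly in between, and strict monotonicity makes it unique.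
  With squared singular values for \<open>s\<close> this solves the parameter equation.\<close>

lemma filter_sum_ex1:
  fixes s z :: "nat \<Rightarrow> real"
  assumes s: "\<And>j. j < l \<Longrightarrow> 0 < s j" and "0 < d" "d < (\<Sum>j<l. (z j)\<^sup>2)" and p: "0 < p"
  shows "\<exists>!a. 0 < a \<and> (\<Sum>j<l. (a / (s j + a)) ^ p * (z j)\<^sup>2) = d"
proof -
  define g where "g a = (\<Sum>j<l. (a / (s j + a)) ^ p * (z j)\<^sup>2)" for a
  have z: "\<exists>j<l. z j \<noteq> 0"
  proof (rule ccontr)
    assume "\<not> (\<exists>j<l. z j \<noteq> 0)"
    then have "(\<Sum>j<l. (z j)\<^sup>2) = 0" by auto
    then show False using assms by simp
  qed
  have mono: "g a < g b" if "0 \<le> a" "a < b" for a b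
    unfolding g_def by (rule filter_sum_strict_mono[OF s z that p])
  have lim1: "((\<lambda>a::real. a / (c + a)) \<longlongrightarrow> 1) at_top" if "0 < c" for c
  proof -
    have "((\<lambda>a::real. 1 - c / (c + a)) \<longlongrightarrow> 1 - 0) at_top"
      by (intro tendsto_diff tendsto_const tendsto_divide_0[OF tendsto_const]
          filterlim_at_top_imp_at_infinity filterlim_tendsto_add_at_top[OF tendsto_const]
          filterlim_ident)
    moreover have "\<forall>\<^sub>F a::real in at_top. 1 - c / (c + a) = a / (c + a)"
      using eventually_gt_at_top[of 0] by eventually_elim (use that in \<open>simp add: field_simps\<close>)
    ultimately show ?thesis by (simp add: tendsto_cong)
  qed
  have "(g \<longlongrightarrow> (\<Sum>j<l. 1 ^ p * (z j)\<^sup>2)) at_top"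
    unfolding g_def using s by (intro tendsto_intros lim1) auto
  then have "\<forall>\<^sub>F a in at_top. d < g a"
    using assms by (intro order_tendstoD(1)) auto
  then have "\<forall>\<^sub>F a in at_top. d < g a \<and> 0 < a"
    using eventually_gt_at_top[of 0] by (rule eventually_conj)
  then obtain b where b: "d < g b" "0 < b"
    using eventually_happens[of _ "at_top :: real filter"] by auto
  have cont: "continuous_on {0..b} g"
    unfolding g_def using s by (intro continuous_intros) (auto, smt (verit))
  \<comment> \<open>\<open>0 < p\<close> excludes the value \<open>0 ^ 0 = 1\<close>.\<close>
  have g0: "g 0 = 0" using p by (simp add: g_def)
  obtain a where a: "0 \<le> a" "a \<le> b" "g a = d"
    using IVT'[of g 0 d b] b g0 cont assms by auto
  have "0 < a" using a g0 assms by (cases "a = 0") auto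
  moreover have "a' = a" if "0 < a'" "g a' = d" for a'
  proof (rule ccontr)
    assume "a' \<noteq> a"
    then consider "a' < a" | "a < a'" by linarith
    then show False
      using mono[of a' a] mono[of a a'] that a \<open>0 < a\<close> by cases auto
  qed
  ultimately show ?thesis using a unfolding g_def by blast
qed

text \<open>This is a geometric sum with ratio \<open>q = b / (s\<^sup>2 + b)\<close>: the
  \<open>k\<close>-th term is \<open>q ^ (k - 1) * (s / (s\<^sup>2 + b))\<close>, and
  \<open>s / (s\<^sup>2 + b) = (1 - q) / s\<close>.\<close>

lemma iterated_filter:
  fixes s b :: real
  assumes "0 < s" "0 < b"
  shows "(\<Sum>k=1..i. b ^ (k - 1) * (s / (s\<^sup>2 + b) ^ k)) = (1 - (b / (s\<^sup>2 + b)) ^ i) / s"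
proof (induction i)
  case (Suc i)
  have ring: "(1 - R) / s + R * ((1 - q) / s) = (1 - q * R) / s" for R q
    using assms by (simp add: field_simps)
  have D: "s\<^sup>2 + b > 0" using assms by (simp add: add_pos_pos)
  have "(\<Sum>k=1..Suc i. b ^ (k - 1) * (s / (s\<^sup>2 + b) ^ k))
      = (1 - (b / (s\<^sup>2 + b)) ^ i) / s + b ^ i * (s / (s\<^sup>2 + b) ^ Suc i)"
    using Suc by simp
  also have "b ^ i * (s / (s\<^sup>2 + b) ^ Suc i) = (b / (s\<^sup>2 + b)) ^ i * (s / (s\<^sup>2 + b))"
    by (simp add: power_divide)
  also have "s / (s\<^sup>2 + b) = (1 - b / (s\<^sup>2 + b)) / s"
    using D assms by (simp add: divide_simps) (simp add: power2_eq_square algebra_simps)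
  also have "(1 - (b / (s\<^sup>2 + b)) ^ i) / s + (b / (s\<^sup>2 + b)) ^ i * ((1 - b / (s\<^sup>2 + b)) / s)
      = (1 - (b / (s\<^sup>2 + b)) ^ Suc i) / s"
    using ring by simp
  finally show ?case .
qed simp

text \<open>With \<open>r = t / (s\<^sup>2 + t)\<close> and \<open>e = y - z\<close>, the derivative in \<open>t\<close> of the error is
  \<open>2 i / t\<^sup>2\<close> times \<open>\<Sum> r\<^bsup>2i+1\<^esup> z\<^sup>2 + \<Sum> e r\<^bsup>i+1\<^esup> z\<close>. By Cauchy-Schwarz the second sum is
  at least \<open>- \<delta> sqrt (\<Sum> r\<^bsup>2i+1\<^esup> z\<^sup>2)\<close>, and the first one is at least \<open>\<delta>\<^sup>2\<close>.\<close>

lemma filtered_error_mono: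
  fixes s y z :: "nat \<Rightarrow> real"
  assumes s: "\<And>j. j < l \<Longrightarrow> 0 < s j" and i: "1 \<le> i" and "0 \<le> \<delta>"
    and e: "(\<Sum>j<l. (y j - z j)\<^sup>2) \<le> \<delta>\<^sup>2"
    and "0 < a" "a \<le> b"
    and eq: "(\<Sum>j<l. (a / ((s j)\<^sup>2 + a)) ^ (2 * i + 1) * (z j)\<^sup>2) = \<delta>\<^sup>2"
  shows "(\<Sum>j<l. (y j / s j - (1 - (a / ((s j)\<^sup>2 + a)) ^ i) / s j * z j)\<^sup>2)
       \<le> (\<Sum>j<l. (y j / s j - (1 - (b / ((s j)\<^sup>2 + b)) ^ i) / s j * z j)\<^sup>2)"
proof (rule DERIV_nonneg_imp_nondecreasing[OF \<open>a \<le> b\<close>], intro exI conjI)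
  fix t assume t: "a \<le> t" "t \<le> b"
  define r where "r j = t / ((s j)\<^sup>2 + t)" for j
  define F' where "F' = (\<Sum>j<l. 2 * (y j / s j - (1 - r j ^ i) / s j * z j)
      * (i * r j ^ (i - 1) * ((s j)\<^sup>2 / ((s j)\<^sup>2 + t)\<^sup>2) / s j * z j))"
  have t0: "0 < t" using t \<open>0 < a\<close> by simp
  have D: "0 < (s j)\<^sup>2 + t" for j using t0 by (simp add: add_nonneg_pos)
  have r: "0 < r j" "r j \<le> 1" for j
    using t0 D[of j] by (auto simp: r_def)
  show "((\<lambda>t. \<Sum>j<l. (y j / s j - (1 - (t / ((s j)\<^sup>2 + t)) ^ i) / s j * z j)\<^sup>2)
      has_real_derivative F') (at t)"
    unfolding F'_def
  proof (rule DERIV_sum)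
    fix j assume "j \<in> {..<l}"
    have "((\<lambda>t. t / ((s j)\<^sup>2 + t)) has_real_derivative (s j)\<^sup>2 / ((s j)\<^sup>2 + t)\<^sup>2) (at t)"
      using D[of j] by (auto intro!: derivative_eq_intros simp: power2_eq_square)
    note d = DERIV_cdivide[OF DERIV_diff[OF DERIV_const[of 1] DERIV_power[OF this, of i]], of "s j"]
    note d = DERIV_diff[OF DERIV_const[of "y j / s j"] DERIV_cmult_right[OF d, of "z j"]]
    show "((\<lambda>t. (y j / s j - (1 - (t / ((s j)\<^sup>2 + t)) ^ i) / s j * z j)\<^sup>2)
        has_real_derivative 2 * (y j / s j - (1 - r j ^ i) / s j * z j)
          * (i * r j ^ (i - 1) * ((s j)\<^sup>2 / ((s j)\<^sup>2 + t)\<^sup>2) / s j * z j)) (at t)"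
      by (rule DERIV_cong[OF DERIV_power[OF d, of 2]])
        (simp add: r_def mult_ac del: right_diff_distrib_numeral left_diff_distrib_numeral)
  qed
  define S where "S = (\<Sum>j<l. r j ^ (2 * i + 1) * (z j)\<^sup>2)"
  define C where "C = (\<Sum>j<l. (y j - z j) * (r j ^ (i + 1) * z j))"
  have "F' = (\<Sum>j<l. 2 * i / t\<^sup>2 * (r j ^ (2 * i + 1) * (z j)\<^sup>2
      + (y j - z j) * (r j ^ (i + 1) * z j)))"
    unfolding F'_def
  proof (rule sum.cong[OF refl])
    fix j assume "j \<in> {..<l}"
    then have sj: "s j > 0" using s by simp
    \<comment> \<open>This trades the denominators left by differentiation for two further powers of
      \<open>r j\<close>, at the cost of a factor \<open>1 / t\<^sup>2\<close> common to all
      \<open>j\<close>.\<close>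
    have q: "1 / ((s j)\<^sup>2 + t)\<^sup>2 = (r j)\<^sup>2 / t\<^sup>2"
      using t0 D[of j] by (simp add: r_def power_divide)
    \<comment> \<open>The factor \<open>(s j)\<^sup>2\<close> from the derivative of
      \<open>r\<close> absorbs both divisions by \<open>s j\<close>.\<close>
    have cancel: "2 * (Y / s j - X / s j * Z) * (I * R * ((s j)\<^sup>2 / E) / s j * Z)
        = 2 * I * (Y - X * Z) * (R * Z) * (1 / E)" for Y X Z I R E
      using sj by (cases "E = 0") (simp_all add: field_simps power2_eq_square)
    \<comment> \<open>Since \<open>1 \<le> i\<close>, the truncated difference \<open>i - 1\<close>
      is genuine, so \<open>(i - 1) + 2 = i + 1\<close>.\<close>
    have ri: "r j ^ (2 * i + 1) = r j ^ (i - 1) * (r j)\<^sup>2 * r j ^ i"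
        "r j ^ (i + 1) = r j ^ (i - 1) * (r j)\<^sup>2"
      unfolding power_add[symmetric] using i by (simp_all add: mult_2)
    have "2 * (y j / s j - (1 - r j ^ i) / s j * z j)
          * (i * r j ^ (i - 1) * ((s j)\<^sup>2 / ((s j)\<^sup>2 + t)\<^sup>2) / s j * z j)
        = 2 * i * (y j - (1 - r j ^ i) * z j) * (r j ^ (i - 1) * z j) * (1 / ((s j)\<^sup>2 + t)\<^sup>2)"
      unfolding cancel by simp
    \<comment> \<open>Splitting \<open>y j - (1 - r j ^ i) * z j\<close> into
      \<open>(y j - z j) + r j ^ i * z j\<close> separates the data error from the filter
      residual.\<close>
    also have "\<dots> = 2 * i / t\<^sup>2 * (r j ^ (2 * i + 1) * (z j)\<^sup>2
        + (y j - z j) * (r j ^ (i + 1) * z j))"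
      unfolding q ri by (simp add: algebra_simps power2_eq_square add_divide_distrib)
    finally show "2 * (y j / s j - (1 - r j ^ i) / s j * z j)
          * (i * r j ^ (i - 1) * ((s j)\<^sup>2 / ((s j)\<^sup>2 + t)\<^sup>2) / s j * z j)
        = 2 * i / t\<^sup>2 * (r j ^ (2 * i + 1) * (z j)\<^sup>2 + (y j - z j) * (r j ^ (i + 1) * z j))" .
  qed
  then have F': "F' = 2 * i / t\<^sup>2 * (S + C)"
    unfolding S_def C_def by (simp only: sum_distrib_left[symmetric] sum.distrib[symmetric])
  \<comment> \<open>The sum increases with the parameter and equals \<open>\<delta>\<^sup>2\<close>
    at \<open>a\<close>, while \<open>a \<le> t\<close>.\<close>
  have S: "\<delta>\<^sup>2 \<le> S"
    unfolding eq[symmetric] S_def r_def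
    using s t \<open>0 < a\<close> by (intro filter_sum_mono) (auto simp: less_imp_neq[symmetric])
  have S0: "0 \<le> S" using S by (rule order_trans[rotated]) simp
  have "\<bar>C\<bar> \<le> (\<Sum>j<l. \<bar>y j - z j\<bar> * \<bar>r j ^ (i + 1) * z j\<bar>)"
    unfolding C_def abs_mult[symmetric] by (rule sum_abs)
  also have "\<dots> \<le> L2_set (\<lambda>j. y j - z j) {..<l} * L2_set (\<lambda>j. r j ^ (i + 1) * z j) {..<l}"
    by (rule L2_set_mult_ineq)
  also have "\<dots> \<le> \<delta> * sqrt S"
  proof (rule mult_mono)
    show "L2_set (\<lambda>j. y j - z j) {..<l} \<le> \<delta>"
      unfolding L2_set_def by (rule real_le_lsqrt) (use e \<open>0 \<le> \<delta>\<close> in auto)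
    \<comment> \<open>Squaring in Cauchy-Schwarz yields the exponent \<open>2 * i + 2\<close>;
      because \<open>r j \<le> 1\<close> it may be lowered to the exponent \<open>2 * i + 1\<close>
      occurring in \<open>S\<close>.\<close>
    have "r j ^ (2 * (i + 1)) \<le> r j ^ (2 * i + 1)" for j
      using r[of j] by (intro power_decreasing) auto
    then show "L2_set (\<lambda>j. r j ^ (i + 1) * z j) {..<l} \<le> sqrt S"
      unfolding L2_set_def S_def power_mult_distrib power_mult[symmetric]
      by (intro real_sqrt_le_mono sum_mono mult_right_mono) (auto simp: mult.commute)
  qed (use \<open>0 \<le> \<delta>\<close> in \<open>auto intro: L2_set_nonneg\<close>)
  also have "\<dots> \<le> sqrt S * sqrt S"
    using S S0 by (intro mult_right_mono real_le_rsqrt) auto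
  also have "\<dots> = S" using S0 by simp
  finally have "\<bar>C\<bar> \<le> S" .
  then show "0 \<le> F'" unfolding F' by simp
qed

section \<open>Euclidean norm and matrices with orthonormal columns\<close>

lemma norm2_square: "(norm2 v)\<^sup>2 = v \<bullet> v"
  by (simp add: norm2_def scalar_prod_def sum_nonneg)

lemma norm2_le_iff: "norm2 v \<le> norm2 w \<longleftrightarrow> v \<bullet> v \<le> w \<bullet> w"
  by (simp add: norm2_def)

lemma scalar_prod_self_eq_0:
  fixes v :: "real vec"
  assumes "v \<in> carrier_vec n" "v \<bullet> v \<le> 0"
  shows "v = 0\<^sub>v n"
proof -
  have "(\<Sum>j<n. (v $ j)\<^sup>2) = 0"
    using assms by (intro antisym sum_nonneg)
      (auto simp: scalar_prod_def power2_eq_square lessThan_atLeast0)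
  then have "\<forall>j<n. v $ j = 0" by (simp add: sum_nonneg_eq_0_iff)
  then show ?thesis using assms by auto
qed

lemma scalar_prod_diff_self:
  fixes v w :: "real vec"
  assumes "v \<in> carrier_vec n" "w \<in> carrier_vec n"
  shows "(v - w) \<bullet> (v - w) = v \<bullet> v - 2 * (v \<bullet> w) + w \<bullet> w"
  using assms comm_scalar_prod[OF assms]
  by (simp add: scalar_prod_minus_distrib[of _ n] minus_scalar_prod_distrib[of _ n])

lemma orthonormal_cols_mult:
  assumes A: "A \<in> carrier_mat n m" "orthonormal_cols A"
    and B: "B \<in> carrier_mat m k" "orthonormal_cols B"
  shows "orthonormal_cols (A * B)"
proof -
  have "(A * B)\<^sup>T * (A * B) = B\<^sup>T * (A\<^sup>T * A) * B"
    using A B by (simp add: transpose_mult[of _ n m _ k] assoc_mult_mat[of _ k m _ n _ k]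
        assoc_mult_mat[of _ k m _ m _ k] assoc_mult_mat[of _ m n _ m _ k])
  then show ?thesis
    using A B by (simp add: orthonormal_cols_def)
qed

context
  fixes G :: "real mat" and n m :: nat
  assumes G: "G \<in> carrier_mat n m" "orthonormal_cols G"
begin

lemma orthonormal_transpose_mult_vec:
  assumes "c \<in> carrier_vec m"
  shows "G\<^sup>T *\<^sub>v (G *\<^sub>v c) = c"
  using G assms by (simp add: orthonormal_cols_def assoc_mult_mat_vec[symmetric, of _ m n _ m])

lemma orthonormal_scalar_prod:
  assumes "c \<in> carrier_vec m"
  shows "(G *\<^sub>v c) \<bullet> (G *\<^sub>v c) = c \<bullet> c"
  using transpose_vec_mult_scalar[of G n m c "G *\<^sub>v c"] G assms orthonormal_transpose_mult_vec
  by simp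

text \<open>Pythagoras: the part of \<open>x\<close> orthogonal to the range of \<open>G\<close>
  contributes the first two terms, which do not involve \<open>c\<close>; the rest of the vector is
  \<open>G\<close> applied to \<open>G\<^sup>T *\<^sub>v x - c\<close>, whose length
  \<open>G\<close> preserves.\<close>

lemma diff_orthonormal_scalar_prod:
  assumes x: "x \<in> carrier_vec n" and c: "c \<in> carrier_vec m"
  shows "(x - G *\<^sub>v c) \<bullet> (x - G *\<^sub>v c)
    = x \<bullet> x - (G\<^sup>T *\<^sub>v x) \<bullet> (G\<^sup>T *\<^sub>v x) + (G\<^sup>T *\<^sub>v x - c) \<bullet> (G\<^sup>T *\<^sub>v x - c)"
  using G x c orthonormal_scalar_prod[OF c] transpose_vec_mult_scalar[OF G(1) c x]
  by (simp add: scalar_prod_diff_self[of _ n] scalar_prod_diff_self[of _ m])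

text \<open>The choice \<open>c = G\<^sup>T *\<^sub>v x\<close> in the previous identity removes its
  last term, and the left-hand side is nonnegative.\<close>

lemma bessel_inequality:
  assumes x: "x \<in> carrier_vec n"
  shows "(G\<^sup>T *\<^sub>v x) \<bullet> (G\<^sup>T *\<^sub>v x) \<le> x \<bullet> x"
proof -
  have "0 \<le> (x - G *\<^sub>v (G\<^sup>T *\<^sub>v x)) \<bullet> (x - G *\<^sub>v (G\<^sup>T *\<^sub>v x))"
    using norm2_square by (metis zero_le_power2)
  then show ?thesis
    using diff_orthonormal_scalar_prod[OF x, of "G\<^sup>T *\<^sub>v x"] G x
    by (simp add: scalar_prod_diff_self[of _ m])
qed

end

section \<open>Shifted Gram matrices and powers of their inverses\<close>

lemma shifted_gram_mult_vec:
  fixes A :: "real mat"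
  assumes A: "A \<in> carrier_mat m n" and v: "v \<in> carrier_vec n"
  shows "(A\<^sup>T * A + b \<cdot>\<^sub>m 1\<^sub>m n) *\<^sub>v v = A\<^sup>T *\<^sub>v (A *\<^sub>v v) + b \<cdot>\<^sub>v v"
  using A v by (simp add: add_mult_distrib_mat_vec[of _ n n] assoc_mult_mat_vec[of _ n m _ n])
    (auto intro!: eq_vecI)

text \<open>Pairing the equation with \<open>v\<close> shows that the squared norm of
  \<open>A *\<^sub>v v\<close> plus \<open>b\<close> times that of \<open>v\<close> is 0.\<close>

lemma shifted_gram_injective:
  fixes A :: "real mat"
  assumes A: "A \<in> carrier_mat m n" and b: "0 < b" and v: "v \<in> carrier_vec n"
    and 0: "(A\<^sup>T * A + b \<cdot>\<^sub>m 1\<^sub>m n) *\<^sub>v v = 0\<^sub>v n"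
  shows "v = 0\<^sub>v n"
proof -
  have "0 = (A\<^sup>T *\<^sub>v (A *\<^sub>v v) + b \<cdot>\<^sub>v v) \<bullet> v"
    using 0 v by (simp add: shifted_gram_mult_vec[OF A v])
  also have "\<dots> = (A *\<^sub>v v) \<bullet> (A *\<^sub>v v) + b * (v \<bullet> v)"
    using A v transpose_vec_mult_scalar[OF A v, of "A *\<^sub>v v"]
    by (simp add: add_scalar_prod_distrib[of _ n])
  finally have "b * (v \<bullet> v) \<le> 0"
    using norm2_square[of "A *\<^sub>v v"] zero_le_power2[of "norm2 (A *\<^sub>v v)"] by linarith
  then show ?thesis
    using b v by (intro scalar_prod_self_eq_0) (auto simp: mult_le_0_iff)
qed

text \<open>If \<open>M\<close> multiplies coordinates with respect to \<open>G\<close> by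
  \<open>d j\<close>, its inverse divides them by \<open>d j\<close>. Injectivity makes the
  determinant nonzero, so that \<open>mat_inverse M\<close> is not \<open>None\<close> and
  \<open>neg_pow\<close> is a true inverse power. It serves the Tikhonov iterates with the right
  singular vectors as \<open>G\<close>, and the parameter equation with the identity.\<close>

lemma neg_pow_mult_vec:
  assumes M: "M \<in> carrier_mat n n"
    and inj: "\<And>v. v \<in> carrier_vec n \<Longrightarrow> M *\<^sub>v v = 0\<^sub>v n \<Longrightarrow> v = 0\<^sub>v n"
    and G: "G \<in> carrier_mat n m"
    and eig: "\<And>c. c \<in> carrier_vec m \<Longrightarrow> M *\<^sub>v (G *\<^sub>v c) = G *\<^sub>v vec m (\<lambda>j. d j * c $ j)"
    and d: "\<And>j. j < m \<Longrightarrow> d j \<noteq> 0"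
    and c: "c \<in> carrier_vec m"
  shows "neg_pow M k *\<^sub>v (G *\<^sub>v c) = G *\<^sub>v vec m (\<lambda>j. c $ j / d j ^ k)"
proof -
  have "det M \<noteq> 0" using det_0_iff_vec_prod_zero_field[OF M] inj by blast
  then obtain B where B: "mat_inverse M = Some B"
    using mat_inverse(1)[OF M, where b = "()"] det_non_zero_imp_unit[OF M, where b = "()"]
    by (cases "mat_inverse M") blast+
  note inv = mat_inverse(2)[OF M B]
  have step: "B *\<^sub>v (G *\<^sub>v c) = G *\<^sub>v vec m (\<lambda>j. c $ j / d j)" if c: "c \<in> carrier_vec m" for c
  proof -
    let ?c = "vec m (\<lambda>j. c $ j / d j)"
    have "vec m (\<lambda>j. d j * ?c $ j) = c" using c d by auto
    then have "B *\<^sub>v (G *\<^sub>v c) = B *\<^sub>v (M *\<^sub>v (G *\<^sub>v ?c))"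
      using eig[of ?c] by simp
    also have "\<dots> = (B * M) *\<^sub>v (G *\<^sub>v ?c)"
      using inv M G by (intro assoc_mult_mat_vec[symmetric]) auto
    also have "\<dots> = G *\<^sub>v ?c" using inv G by simp
    finally show ?thesis .
  qed
  show ?thesis using c
  \<comment> \<open>The innermost inverse acts first and changes the coordinates, hence the
    generalization over \<open>c\<close>.\<close>
  proof (induction k arbitrary: c)
    case 0
    then have "vec m (\<lambda>j. c $ j) = c" by auto
    then show ?case using 0 B inv G by (auto simp: neg_pow_def)
  next
    case (Suc k)
    have "neg_pow M (Suc k) *\<^sub>v (G *\<^sub>v c) = neg_pow M k *\<^sub>v (B *\<^sub>v (G *\<^sub>v c))"
      using B inv G Suc.prems
      by (simp add: neg_pow_def assoc_mult_mat_vec[of _ n n _ n])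
    also have "\<dots> = G *\<^sub>v vec m (\<lambda>j. vec m (\<lambda>j. c $ j / d j) $ j / d j ^ k)"
      using Suc by (simp add: step)
    also have "vec m (\<lambda>j. vec m (\<lambda>j. c $ j / d j) $ j / d j ^ k) = vec m (\<lambda>j. c $ j / d j ^ Suc k)"
      by auto
    finally show ?case .
  qed
qed

section \<open>Coordinate formulas and positivity of the singular values\<close>

lemma diagonal_mult_vec:
  fixes \<Sigma> :: "real mat"
  assumes "\<Sigma> \<in> carrier_mat (l + 1) l" "diagonal_mat \<Sigma>" "c \<in> carrier_vec l"
  shows "\<Sigma> *\<^sub>v c = vec (l + 1) (\<lambda>j. if j < l then \<Sigma> $$ (j, j) * c $ j else 0)"
proof (rule eq_vecI)
  fix j assume "j < dim_vec (vec (l + 1) (\<lambda>j. if j < l then \<Sigma> $$ (j, j) * c $ j else 0))"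
  then have j: "j < l + 1" by simp
  have "(\<Sigma> *\<^sub>v c) $ j = (\<Sum>k<l. \<Sigma> $$ (j, k) * c $ k)"
    using assms j by (simp add: scalar_prod_def lessThan_atLeast0)
  also have "\<dots> = (\<Sum>k<l. if k = j then \<Sigma> $$ (j, j) * c $ j else 0)"
    using assms j by (intro sum.cong) (auto simp: diagonal_mat_def)
  finally show "(\<Sigma> *\<^sub>v c) $ j = vec (l + 1) (\<lambda>j. if j < l then \<Sigma> $$ (j, j) * c $ j else 0) $ j"
    using j by simp
qed (use assms in simp)

lemma diagonal_transpose_mult_vec:
  fixes \<Sigma> :: "real mat"
  assumes "\<Sigma> \<in> carrier_mat (l + 1) l" "diagonal_mat \<Sigma>" "c \<in> carrier_vec (l + 1)"
  shows "\<Sigma>\<^sup>T *\<^sub>v c = vec l (\<lambda>j. \<Sigma> $$ (j, j) * c $ j)"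
proof (rule eq_vecI)
  fix j assume "j < dim_vec (vec l (\<lambda>j. \<Sigma> $$ (j, j) * c $ j))"
  then have j: "j < l" by simp
  have "(\<Sigma>\<^sup>T *\<^sub>v c) $ j = (\<Sum>k<l+1. \<Sigma> $$ (k, j) * c $ k)"
    using assms j by (simp add: scalar_prod_def lessThan_atLeast0)
  also have "\<dots> = (\<Sum>k<l+1. if k = j then \<Sigma> $$ (j, j) * c $ j else 0)"
    using assms j by (intro sum.cong) (auto simp: diagonal_mat_def)
  finally show "(\<Sigma>\<^sup>T *\<^sub>v c) $ j = vec l (\<lambda>j. \<Sigma> $$ (j, j) * c $ j) $ j"
    using j by simp
qed (use assms in simp)

lemma trunc_id_mult_vec:
  assumes "c \<in> carrier_vec (l + 1)"
  shows "trunc_id l *\<^sub>v c = vec (l + 1) (\<lambda>j. if j < l then c $ j else 0)"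
proof (rule eq_vecI)
  fix j assume "j < dim_vec (vec (l + 1) (\<lambda>j. if j < l then c $ j else 0))"
  then have j: "j < l + 1" by simp
  have "(trunc_id l *\<^sub>v c) $ j = (\<Sum>k<l+1. trunc_id l $$ (j, k) * c $ k)"
    using assms j by (simp add: scalar_prod_def lessThan_atLeast0 trunc_id_def)
  also have "\<dots> = (\<Sum>k<l+1. if k = j then (if j < l then c $ j else 0) else 0)"
    using j by (intro sum.cong) (auto simp: trunc_id_def)
  finally show "(trunc_id l *\<^sub>v c) $ j = vec (l + 1) (\<lambda>j. if j < l then c $ j else 0) $ j"
    using j by simp
qed (simp add: trunc_id_def)

text \<open>Let \<open>j\<close> be the last index with \<open>v $ j \<noteq> 0\<close>. In row
  \<open>j + 1\<close> the entries of \<open>H\<close> left of column \<open>j\<close> vanish by the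
  Hessenberg shape, and the entries of \<open>v\<close> after \<open>j\<close> vanish by maximality.
  Only \<open>H $$ (j + 1, j) * v $ j\<close> survives, which is nonzero.\<close>

lemma hessenberg_injective:
  assumes H: "H \<in> carrier_mat (l + 1) l" "upper_hessenberg H"
    and sub: "\<forall>j<l. H $$ (j + 1, j) \<noteq> 0"
    and v: "v \<in> carrier_vec l" and 0: "H *\<^sub>v v = 0\<^sub>v (l + 1)"
  shows "v = 0\<^sub>v l"
proof (rule ccontr)
  assume "v \<noteq> 0\<^sub>v l"
  define J where "J = {j. j < l \<and> v $ j \<noteq> 0}"
  have "finite J" "J \<noteq> {}" using \<open>v \<noteq> 0\<^sub>v l\<close> v by (auto simp: J_def)
  define j where "j = Max J"
  have j: "j < l" "v $ j \<noteq> 0"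
    using Max_in[OF \<open>finite J\<close> \<open>J \<noteq> {}\<close>] by (auto simp: J_def j_def)
  have top: "v $ k = 0" if "j < k" "k < l" for k
    using Max_ge[OF \<open>finite J\<close>, of k] that by (fastforce simp: J_def j_def)
  have zero: "H $$ (j + 1, k) * v $ k = 0" if "k < l" "k \<noteq> j" for k
    using top[of k] H that j by (cases "k < j") (auto simp: upper_hessenberg_def)
  have "0 = (H *\<^sub>v v) $ (j + 1)" using 0 j by simp
  also have "\<dots> = (\<Sum>k<l. H $$ (j + 1, k) * v $ k)"
    using H v j by (auto simp: scalar_prod_def lessThan_atLeast0 intro!: sum.cong)
  also have "\<dots> = (\<Sum>k<l. if k = j then H $$ (j + 1, j) * v $ j else 0)"
    using zero by (intro sum.cong) auto
  also have "\<dots> = H $$ (j + 1, j) * v $ j" using j by simp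
  finally show False using sub j by simp
qed

text \<open>If the singular value were zero, column \<open>j\<close> of \<open>S\<close> would be a
  nonzero kernel vector of \<open>H\<close>.\<close>

lemma svd_sigma_pos:
  assumes svd: "is_svd H W \<Sigma> S"
    and H: "H \<in> carrier_mat (l + 1) l" "upper_hessenberg H" "\<forall>j<l. H $$ (j + 1, j) \<noteq> 0"
    and j: "j < l"
  shows "0 < \<Sigma> $$ (j, j)"
proof (rule ccontr)
  assume "\<not> 0 < \<Sigma> $$ (j, j)"
  have W: "W \<in> carrier_mat (l + 1) (l + 1)" and S: "S \<in> carrier_mat l l" "orthonormal_cols S"
    and \<Sigma>: "\<Sigma> \<in> carrier_mat (l + 1) l" "diagonal_mat \<Sigma>" "0 \<le> \<Sigma> $$ (j, j)"
    and eq: "H = W * \<Sigma> * S\<^sup>T"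
    using svd H j by (auto simp: is_svd_def)
  have "\<Sigma> *\<^sub>v unit_vec l j = 0\<^sub>v (l + 1)"
    using \<Sigma> \<open>\<not> 0 < \<Sigma> $$ (j, j)\<close> j
    by (subst diagonal_mult_vec[of _ l]) (auto simp: unit_vec_def)
  moreover have "W *\<^sub>v 0\<^sub>v (l + 1) = 0\<^sub>v (l + 1)" using W by auto
  ultimately have "H *\<^sub>v (S *\<^sub>v unit_vec l j) = 0\<^sub>v (l + 1)"
    using W S \<Sigma> unfolding eq
    by (simp add: assoc_mult_mat_vec[of _ "l + 1" l _ l] assoc_mult_mat_vec[of _ "l + 1" "l + 1" _ l]
        orthonormal_transpose_mult_vec[of _ l l])
  then have "S *\<^sub>v unit_vec l j = 0\<^sub>v l"
    by (rule hessenberg_injective[OF H, rotated]) (use S in simp)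
  then have "unit_vec l j = S\<^sup>T *\<^sub>v 0\<^sub>v l"
    using orthonormal_transpose_mult_vec[OF S, of "unit_vec l j"] by simp
  also have "\<dots> = 0\<^sub>v l" using S by auto
  finally show False using j by simp
qed

section \<open>Iterates and parameter equation in singular coordinates\<close>

text \<open>In the coordinates of \<open>G\<close>, the shifted Gram matrix multiplies by
  \<open>(s j)\<^sup>2 + b\<close>, and \<open>A\<^sup>T *\<^sub>v y\<close> has coefficients
  \<open>s j * u $ j\<close>. Each term of the iteration is thus explicit, and
  \<open>iterated_filter\<close> sums them.\<close>

lemma iter_tikhonov_svd:
  fixes \<Sigma> :: "real mat"
  assumes U: "U \<in> carrier_mat n1 (l + 1)" "orthonormal_cols U"
    and G: "G \<in> carrier_mat n2 l" "orthonormal_cols G"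
    and \<Sigma>: "\<Sigma> \<in> carrier_mat (l + 1) l" "diagonal_mat \<Sigma>"
    and pos: "\<And>j. j < l \<Longrightarrow> 0 < \<Sigma> $$ (j, j)"
    and A: "A = U * \<Sigma> * G\<^sup>T" and y: "y \<in> carrier_vec n1" and b: "0 < b"
  shows "iter_tikhonov i A y b = G *\<^sub>v vec l (\<lambda>j.
    (1 - (b / ((\<Sigma> $$ (j, j))\<^sup>2 + b)) ^ i) / \<Sigma> $$ (j, j) * (U\<^sup>T *\<^sub>v y) $ j)"
proof -
  define s where "s j = \<Sigma> $$ (j, j)" for j
  define u where "u = U\<^sup>T *\<^sub>v y"
  have u: "u \<in> carrier_vec (l + 1)" using U y by (simp add: u_def)
  have Ac: "A \<in> carrier_mat n1 n2" using U G \<Sigma> by (simp add: A)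
  have AT: "A\<^sup>T *\<^sub>v w = G *\<^sub>v (\<Sigma>\<^sup>T *\<^sub>v (U\<^sup>T *\<^sub>v w))" if "w \<in> carrier_vec n1" for w
    using U G \<Sigma> that unfolding A
    by (simp add: transpose_mult[of _ n1 "l + 1" _ n2] transpose_mult[of _ "l + 1" l _ n2]
        assoc_mult_mat_vec[of _ n2 l _ n1] assoc_mult_mat_vec[of _ l "l + 1" _ n1])
  have AG: "A *\<^sub>v (G *\<^sub>v c) = U *\<^sub>v (\<Sigma> *\<^sub>v c)" if "c \<in> carrier_vec l" for c
    using U G \<Sigma> that unfolding A
    by (simp add: assoc_mult_mat_vec[of _ n1 "l + 1" _ n2] assoc_mult_mat_vec[of _ "l + 1" l _ n2]
        orthonormal_transpose_mult_vec[of _ n2 l])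
  let ?M = "A\<^sup>T * A + b \<cdot>\<^sub>m 1\<^sub>m n2"
  have eig: "?M *\<^sub>v (G *\<^sub>v c) = G *\<^sub>v vec l (\<lambda>j. ((s j)\<^sup>2 + b) * c $ j)" if c: "c \<in> carrier_vec l" for c
  proof -
    have "A\<^sup>T *\<^sub>v (A *\<^sub>v (G *\<^sub>v c)) = G *\<^sub>v (\<Sigma>\<^sup>T *\<^sub>v (\<Sigma> *\<^sub>v c))"
      using U \<Sigma> c by (simp add: AG AT orthonormal_transpose_mult_vec[of _ n1 "l + 1"])
    also have "\<Sigma>\<^sup>T *\<^sub>v (\<Sigma> *\<^sub>v c) = vec l (\<lambda>j. (s j)\<^sup>2 * c $ j)"
      using \<Sigma> c diagonal_mult_vec[OF \<Sigma> c] diagonal_transpose_mult_vec[OF \<Sigma>, of "\<Sigma> *\<^sub>v c"]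
      by (auto simp: s_def power2_eq_square)
    finally have "?M *\<^sub>v (G *\<^sub>v c) = G *\<^sub>v vec l (\<lambda>j. (s j)\<^sup>2 * c $ j) + b \<cdot>\<^sub>v (G *\<^sub>v c)"
      using Ac G c by (simp add: shifted_gram_mult_vec[of _ n1])
    also have "\<dots> = G *\<^sub>v (vec l (\<lambda>j. (s j)\<^sup>2 * c $ j) + b \<cdot>\<^sub>v c)"
      using G c by (simp add: mult_add_distrib_mat_vec[of _ n2 l] mult_mat_vec[of _ n2 l])
    also have "vec l (\<lambda>j. (s j)\<^sup>2 * c $ j) + b \<cdot>\<^sub>v c = vec l (\<lambda>j. ((s j)\<^sup>2 + b) * c $ j)"
      using c by (auto simp: algebra_simps)
    finally show ?thesis .
  qed
  have ATy: "A\<^sup>T *\<^sub>v y = G *\<^sub>v vec l (\<lambda>j. s j * u $ j)"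
    using AT[OF y] diagonal_transpose_mult_vec[OF \<Sigma> u] by (simp add: u_def s_def)
  have d: "(s j)\<^sup>2 + b \<noteq> 0" for j using b by (smt (verit) zero_le_power2)
  have pow: "neg_pow ?M k *\<^sub>v (A\<^sup>T *\<^sub>v y) = G *\<^sub>v vec l (\<lambda>j. s j * u $ j / ((s j)\<^sup>2 + b) ^ k)" for k
  proof -
    have "neg_pow ?M k *\<^sub>v (A\<^sup>T *\<^sub>v y)
        = G *\<^sub>v vec l (\<lambda>j. vec l (\<lambda>j. s j * u $ j) $ j / ((s j)\<^sup>2 + b) ^ k)"
      unfolding ATy
      by (rule neg_pow_mult_vec[OF _ shifted_gram_injective[OF Ac b] G(1) eig d]) (use Ac in auto)
    also have "vec l (\<lambda>j. vec l (\<lambda>j. s j * u $ j) $ j / ((s j)\<^sup>2 + b) ^ k)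
        = vec l (\<lambda>j. s j * u $ j / ((s j)\<^sup>2 + b) ^ k)"
      by auto
    finally show ?thesis .
  qed
  let ?f = "\<lambda>k. b ^ (k - 1) \<cdot>\<^sub>v (G *\<^sub>v vec l (\<lambda>j. s j * u $ j / ((s j)\<^sup>2 + b) ^ k))"
  let ?g = "vec l (\<lambda>j. (1 - (b / ((s j)\<^sup>2 + b)) ^ i) / s j * u $ j)"
  have f: "?f \<in> {1..i} \<rightarrow> carrier_vec n2" using G by auto
  have "iter_tikhonov i A y b = finsum_vec TYPE(real) n2 ?f {1..i}"
    using Ac by (simp add: iter_tikhonov_def pow)
  also have "\<dots> = G *\<^sub>v ?g"
  \<comment> \<open>Entrywise, the vector sum becomes a double sum of reals whose order can be
    exchanged, leaving the geometric sum over \<open>k\<close> inside.\<close>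
  proof (rule eq_vecI)
    fix p assume "p < dim_vec (G *\<^sub>v ?g)"
    then have p: "p < n2" using G by simp
    have "finsum_vec TYPE(real) n2 ?f {1..i} $ p = (\<Sum>k=1..i. ?f k $ p)"
      using p f by (intro index_finsum_vec) auto
    also have "\<dots> = (\<Sum>k=1..i. \<Sum>j<l. G $$ (p, j) * u $ j * (b ^ (k - 1) * (s j / ((s j)\<^sup>2 + b) ^ k)))"
      using G p by (intro sum.cong)
        (auto simp: scalar_prod_def lessThan_atLeast0 sum_distrib_left mult_ac intro!: sum.cong)
    also have "\<dots> = (\<Sum>j<l. G $$ (p, j) * u $ j * (\<Sum>k=1..i. b ^ (k - 1) * (s j / ((s j)\<^sup>2 + b) ^ k)))"
      by (subst sum.swap) (simp add: sum_distrib_left)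
    also have "\<dots> = (\<Sum>j<l. G $$ (p, j) * ((1 - (b / ((s j)\<^sup>2 + b)) ^ i) / s j * u $ j))"
      using pos b by (intro sum.cong refl) (subst iterated_filter, auto simp: s_def)
    also have "\<dots> = (G *\<^sub>v ?g) $ p"
      using G p by (simp add: scalar_prod_def lessThan_atLeast0)
    finally show "finsum_vec TYPE(real) n2 ?f {1..i} $ p = (G *\<^sub>v ?g) $ p" .
  next
    show "dim_vec (finsum_vec TYPE(real) n2 ?f {1..i}) = dim_vec (G *\<^sub>v ?g)"
      using finsum_vec_closed[OF f] G by auto
  qed
  finally show ?thesis by (simp add: s_def u_def)
qed

text \<open>The shifted matrix of order \<open>l + 1\<close> is diagonal. Its last diagonal entry is
  just \<open>a\<close>, but the truncated data vanish there, so only the first \<open>l\<close>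
  indices contribute.\<close>

lemma param_eq_svd:
  fixes \<Sigma> :: "real mat"
  assumes \<Sigma>: "\<Sigma> \<in> carrier_mat (l + 1) l" "diagonal_mat \<Sigma>" and a: "0 < a"
  shows "param_eq i \<Sigma> (vec (l + 1) (\<lambda>j. if j < l then u $ j else 0)) \<delta> a \<longleftrightarrow>
    (\<Sum>j<l. (a / ((\<Sigma> $$ (j, j))\<^sup>2 + a)) ^ (2 * i + 1) * (u $ j)\<^sup>2) = \<delta>\<^sup>2"
proof -
  define d where "d j = (if j < l then (\<Sigma> $$ (j, j))\<^sup>2 else 0) + a" for j
  define z where "z = vec (l + 1) (\<lambda>j. if j < l then u $ j else 0)"
  have z: "z \<in> carrier_vec (l + 1)" by (simp add: z_def)
  have d: "d j \<noteq> 0" for j using a by (smt (verit) d_def zero_le_power2)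
  let ?M = "\<Sigma> * \<Sigma>\<^sup>T + a \<cdot>\<^sub>m 1\<^sub>m (l + 1)"
  have \<Sigma>T: "\<Sigma>\<^sup>T \<in> carrier_mat l (l + 1)" using \<Sigma> by simp
  have eig: "?M *\<^sub>v (1\<^sub>m (l + 1) *\<^sub>v c) = 1\<^sub>m (l + 1) *\<^sub>v vec (l + 1) (\<lambda>j. d j * c $ j)"
    if c: "c \<in> carrier_vec (l + 1)" for c
  proof -
    have "?M *\<^sub>v (1\<^sub>m (l + 1) *\<^sub>v c) = \<Sigma> *\<^sub>v (\<Sigma>\<^sup>T *\<^sub>v c) + a \<cdot>\<^sub>v c"
      using shifted_gram_mult_vec[OF \<Sigma>T c, of a] c by simp
    also have "\<Sigma> *\<^sub>v (\<Sigma>\<^sup>T *\<^sub>v c)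
        = vec (l + 1) (\<lambda>j. if j < l then \<Sigma> $$ (j, j) * (\<Sigma> $$ (j, j) * c $ j) else 0)"
      using \<Sigma> diagonal_mult_vec[OF \<Sigma>, of "\<Sigma>\<^sup>T *\<^sub>v c"] diagonal_transpose_mult_vec[OF \<Sigma> c]
      by (auto intro!: eq_vecI)
    finally show ?thesis
      using c by (auto simp: d_def power2_eq_square algebra_simps intro!: eq_vecI)
  qed
  \<comment> \<open>The matrix is a shifted Gram matrix of \<open>\<Sigma>\<^sup>T\<close> instead
    of \<open>\<Sigma>\<close>.\<close>
  have inj: "w = 0\<^sub>v (l + 1)" if "w \<in> carrier_vec (l + 1)" "?M *\<^sub>v w = 0\<^sub>v (l + 1)" for w
    using shifted_gram_injective[OF \<Sigma>T a that(1)] that(2) by simp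
  have M: "?M \<in> carrier_mat (l + 1) (l + 1)" using \<Sigma> by simp
  have "neg_pow ?M (2 * i + 1) *\<^sub>v (1\<^sub>m (l + 1) *\<^sub>v z)
      = 1\<^sub>m (l + 1) *\<^sub>v vec (l + 1) (\<lambda>j. z $ j / d j ^ (2 * i + 1))"
    by (rule neg_pow_mult_vec[OF M inj one_carrier_mat eig d z])
  then have "neg_pow ?M (2 * i + 1) *\<^sub>v z = vec (l + 1) (\<lambda>j. z $ j / d j ^ (2 * i + 1))"
    using z by simp
  then have "a ^ (2 * i + 1) * (z \<bullet> (neg_pow ?M (2 * i + 1) *\<^sub>v z))
      = a ^ (2 * i + 1) * (\<Sum>j<l+1. z $ j * (z $ j / d j ^ (2 * i + 1)))"
    by (simp add: scalar_prod_def lessThan_atLeast0)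
  also have "(\<Sum>j<l+1. z $ j * (z $ j / d j ^ (2 * i + 1))) = (\<Sum>j<l. (u $ j)\<^sup>2 / d j ^ (2 * i + 1))"
    by (simp add: z_def power2_eq_square)
  also have "a ^ (2 * i + 1) * (\<Sum>j<l. (u $ j)\<^sup>2 / d j ^ (2 * i + 1))
      = (\<Sum>j<l. (a / ((\<Sigma> $$ (j, j))\<^sup>2 + a)) ^ (2 * i + 1) * (u $ j)\<^sup>2)"
    unfolding sum_distrib_left by (intro sum.cong) (auto simp: d_def power_divide)
  finally show ?thesis using \<Sigma> by (simp add: param_eq_def z_def)
qed

section \<open>Preparation of the Arnoldi, Golub-Kahan and pseudoinverse data\<close>

lemma orthonormal_first_cols:
  assumes V: "V \<in> carrier_mat n (l + 1)" and o: "orthonormal_cols V"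
  shows "orthonormal_cols (first_cols l V)"
proof -
  have dim: "dim_col (first_cols l V) = l" by (simp add: first_cols_def)
  have c: "col (first_cols l V) j = col V j" if "j < l" for j
    using V that by (auto simp: first_cols_def)
  have "col V j \<bullet> col V k = (if j = k then 1 else 0)" if "j < l" "k < l" for j k
  proof -
    have "col V j \<bullet> col V k = (V\<^sup>T * V) $$ (j, k)" using V that by simp
    also have "\<dots> = (if j = k then 1 else 0)"
      using V that by (subst o[unfolded orthonormal_cols_def]) auto
    finally show ?thesis .
  qed
  then show ?thesis
    unfolding orthonormal_cols_def
    by (intro eq_matI) (auto simp: c dim)
qed

lemma lower_bidiagonal_imp_upper_hessenberg: "lower_bidiagonal A \<Longrightarrow> upper_hessenberg A"
  by (auto simp: lower_bidiagonal_def upper_hessenberg_def)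

text \<open>Writing \<open>y = T *\<^sub>v w\<close>, the claim is the first Penrose equation
  applied to \<open>w\<close>.\<close>

lemma moore_penrose_solves:
  assumes T: "T \<in> carrier_mat n1 n2" and y: "y \<in> vec_space.col_space n1 T"
    and mp: "moore_penrose T Tp"
  shows "y \<in> carrier_vec n1" "Tp *\<^sub>v y \<in> carrier_vec n2" "T *\<^sub>v (Tp *\<^sub>v y) = y"
proof -
  have Tp: "Tp \<in> carrier_mat n2 n1" "T * Tp * T = T"
    using mp T by (auto simp: moore_penrose_def)
  obtain w where w: "w \<in> carrier_vec n2" "y = T *\<^sub>v w"
    using y T by (auto simp: vec_space.col_space_eq[OF T])
  show "y \<in> carrier_vec n1" "Tp *\<^sub>v y \<in> carrier_vec n2" using w T Tp by auto
  have "T *\<^sub>v (Tp *\<^sub>v (T *\<^sub>v w)) = (T * Tp * T) *\<^sub>v w"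
    using T Tp(1) w by (simp add: assoc_mult_mat_vec[of _ n1 n1 _ n2] assoc_mult_mat_vec[of _ n1 n2 _ n1]
        del: assoc_mult_mat)
  then show "T *\<^sub>v (Tp *\<^sub>v y) = y" using Tp w by simp
qed

lemma scalar_prod_diff_sum:
  fixes v w :: "real vec"
  assumes "v \<in> carrier_vec n" "w \<in> carrier_vec n"
  shows "(v - w) \<bullet> (v - w) = (\<Sum>j<n. (v $ j - w $ j)\<^sup>2)"
  using assms by (auto simp: scalar_prod_def power2_eq_square lessThan_atLeast0)

section \<open>The common statement for both processes\<close>

text \<open>For Arnoldi, \<open>Q\<close> is the full basis and \<open>P\<close> its first
  \<open>l\<close> columns; for Golub-Kahan they are the left and right bases. The singular value
  decomposition of \<open>H\<close> reduces everything to sums over \<open>j < l\<close>.\<close>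

lemma projected_discrepancy_choice:
  assumes i: "1 \<le> i" and \<delta>: "0 < \<delta>"
    and T: "T \<in> carrier_mat n1 n2" and yT: "y \<in> vec_space.col_space n1 T"
    and mp: "moore_penrose T Tp" and x_def: "x = Tp *\<^sub>v y"
    and yd: "yd \<in> carrier_vec n1" and noise: "norm2 (y - yd) \<le> \<delta>"
    and Q: "Q \<in> carrier_mat n1 (l + 1)" "orthonormal_cols Q"
    and P: "P \<in> carrier_mat n2 l" "orthonormal_cols P"
    and H: "H \<in> carrier_mat (l + 1) l" "upper_hessenberg H" "\<forall>j<l. H $$ (j + 1, j) \<noteq> 0"
    and svd: "is_svd H W \<Sigma> S"
    and A_def: "A = Q * H * P\<^sup>T" and R_def: "R = range_proj l Q W" and z_def: "z = trunc_data l Q W yd"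
    and RT: "(R * T) *\<^sub>v x = A *\<^sub>v x" and \<delta>R: "\<delta> \<le> norm2 (R *\<^sub>v yd)"
  shows "norm2 (R *\<^sub>v yd) = norm2 z \<and>
    (\<delta> < norm2 (R *\<^sub>v yd) \<longrightarrow> (\<exists>!a. 0 < a \<and> param_eq i \<Sigma> z \<delta> a)) \<and>
    (\<forall>a. 0 < a \<and> param_eq i \<Sigma> z \<delta> a \<longrightarrow>
      (\<forall>a' \<ge> a. norm2 (x - iter_tikhonov i A yd a) \<le> norm2 (x - iter_tikhonov i A yd a')))"
proof -
  have W: "W \<in> carrier_mat (l + 1) (l + 1)" "orthonormal_cols W"
    and S: "S \<in> carrier_mat l l" "orthonormal_cols S"
    and \<Sigma>: "\<Sigma> \<in> carrier_mat (l + 1) l" "diagonal_mat \<Sigma>" and Heq: "H = W * \<Sigma> * S\<^sup>T"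
    using svd H by (auto simp: is_svd_def)
  define s where "s j = \<Sigma> $$ (j, j)" for j
  define U where "U = Q * W"
  define G where "G = P * S"
  define u where "u = U\<^sup>T *\<^sub>v yd"
  define v where "v = U\<^sup>T *\<^sub>v y"
  have pos: "0 < s j" if "j < l" for j
    unfolding s_def using svd_sigma_pos[OF svd H that] .
  have U: "U \<in> carrier_mat n1 (l + 1)" "orthonormal_cols U"
    using Q W orthonormal_cols_mult[of Q n1 "l + 1" W "l + 1"] by (auto simp: U_def)
  have G: "G \<in> carrier_mat n2 l" "orthonormal_cols G"
    using P S orthonormal_cols_mult[of P n2 l S l] by (auto simp: G_def)
  have UT: "W\<^sup>T *\<^sub>v (Q\<^sup>T *\<^sub>v b) = U\<^sup>T *\<^sub>v b" if "b \<in> carrier_vec n1" for b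
    using Q W that unfolding U_def
    by (simp add: transpose_mult[of _ n1 "l + 1" _ "l + 1"] assoc_mult_mat_vec[of _ "l + 1" "l + 1" _ n1])
  have J: "trunc_id l \<in> carrier_mat (l + 1) (l + 1)"
    unfolding trunc_id_def by (intro four_block_carrier_mat) auto
  have A: "A = U * \<Sigma> * G\<^sup>T"
    using Q W \<Sigma> S P unfolding A_def Heq U_def G_def
    by (simp add: transpose_mult[of _ n2 l _ l] assoc_mult_mat[of _ n1 "l + 1" _ "l + 1" _ n2]
        assoc_mult_mat[of _ n1 "l + 1" _ l _ n2] assoc_mult_mat[of _ "l + 1" "l + 1" _ l _ n2])
  have Rb: "R *\<^sub>v b = U *\<^sub>v (trunc_id l *\<^sub>v (U\<^sup>T *\<^sub>v b))" if b: "b \<in> carrier_vec n1" for b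
  proof -
    have "R = U * trunc_id l * W\<^sup>T * Q\<^sup>T" by (simp add: R_def range_proj_def U_def)
    then have "R *\<^sub>v b = U *\<^sub>v (trunc_id l *\<^sub>v (W\<^sup>T *\<^sub>v (Q\<^sup>T *\<^sub>v b)))"
      using U(1) J W Q b
      by (simp add: assoc_mult_mat[of _ n1 "l + 1" _ "l + 1" _ "l + 1"]
          assoc_mult_mat[of _ n1 "l + 1" _ "l + 1" _ n1] assoc_mult_mat[of _ "l + 1" "l + 1" _ "l + 1" _ n1]
          assoc_mult_mat_vec[of _ n1 "l + 1" _ n1] assoc_mult_mat_vec[of _ "l + 1" "l + 1" _ n1])
    then show ?thesis using UT[OF b] by simp
  qed
  have uc: "u \<in> carrier_vec (l + 1)" using U yd by (simp add: u_def)
  have z: "z = vec (l + 1) (\<lambda>j. if j < l then u $ j else 0)"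
    using UT[OF yd] trunc_id_mult_vec[OF uc] by (simp add: z_def trunc_data_def u_def)
  have Rz: "R *\<^sub>v yd = U *\<^sub>v z"
    using Rb[OF yd] UT[OF yd] by (simp add: z_def trunc_data_def)
  have zc: "z \<in> carrier_vec (l + 1)" by (simp add: z)
  have norm_eq: "norm2 (R *\<^sub>v yd) = norm2 z"
    using orthonormal_scalar_prod[OF U zc] by (simp add: Rz norm2_def)
  have z2: "z \<bullet> z = (\<Sum>j<l. (u $ j)\<^sup>2)"
    by (simp add: z scalar_prod_def power2_eq_square lessThan_atLeast0[symmetric])
  note param = param_eq_svd[OF \<Sigma>, where u = u, folded z s_def]
  \<comment> \<open>The inequality is strict because the filter sum stays strictly below the squared
    norm of \<open>z\<close> for every finite parameter and only tends to it.\<close>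
  have ex: "\<exists>!a. 0 < a \<and> param_eq i \<Sigma> z \<delta> a" if "\<delta> < norm2 (R *\<^sub>v yd)"
  proof -
    have "\<delta>\<^sup>2 < (norm2 z)\<^sup>2"
      using that \<delta> unfolding norm_eq by (intro power_strict_mono) auto
    then have "\<delta>\<^sup>2 < (\<Sum>j<l. (u $ j)\<^sup>2)" by (simp add: norm2_square z2)
    then have "\<exists>!a. 0 < a \<and> (\<Sum>j<l. (a / ((s j)\<^sup>2 + a)) ^ (2 * i + 1) * (u $ j)\<^sup>2) = \<delta>\<^sup>2"
      using pos \<delta> by (intro filter_sum_ex1) (auto simp: less_imp_neq[symmetric])
    then show ?thesis using param by (simp cong: conj_cong)
  qed
  have y: "y \<in> carrier_vec n1" and x: "x \<in> carrier_vec n2" and Tx: "T *\<^sub>v x = y"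
    using moore_penrose_solves[OF T yT mp] by (simp_all add: x_def)
  have vc: "v \<in> carrier_vec (l + 1)" using U y by (simp add: v_def)
  have Gx: "G\<^sup>T *\<^sub>v x \<in> carrier_vec l" using G x by simp
  have Rc: "R \<in> carrier_mat n1 n1"
    unfolding R_def range_proj_def by (rule carrier_matI) (use carrier_matD(1)[OF Q(1)] in simp_all)
  have "(R * T) *\<^sub>v x = R *\<^sub>v y"
    using assoc_mult_mat_vec[OF Rc T x] Tx by simp
  then have "U *\<^sub>v (trunc_id l *\<^sub>v v) = A *\<^sub>v x"
    using RT Rb[OF y] by (simp add: v_def)
  also have "A *\<^sub>v x = U *\<^sub>v (\<Sigma> *\<^sub>v (G\<^sup>T *\<^sub>v x))"
    using U \<Sigma> G x unfolding A
    by (simp add: assoc_mult_mat_vec[of _ n1 l _ n2] assoc_mult_mat_vec[of _ n1 "l + 1" _ l] del: assoc_mult_mat)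
  finally have UJ: "U *\<^sub>v (trunc_id l *\<^sub>v v) = U *\<^sub>v (\<Sigma> *\<^sub>v (G\<^sup>T *\<^sub>v x))" .
  \<comment> \<open>Multiplying by \<open>U\<^sup>T\<close> cancels \<open>U\<close> on both sides,
    leaving an identity of coordinate vectors.\<close>
  have "trunc_id l *\<^sub>v v = U\<^sup>T *\<^sub>v (U *\<^sub>v (trunc_id l *\<^sub>v v))"
    using J vc by (intro orthonormal_transpose_mult_vec[OF U, symmetric] mult_mat_vec_carrier)
  also have "\<dots> = \<Sigma> *\<^sub>v (G\<^sup>T *\<^sub>v x)"
    unfolding UJ by (intro orthonormal_transpose_mult_vec[OF U] mult_mat_vec_carrier[OF \<Sigma>(1) Gx])
  finally have JG: "trunc_id l *\<^sub>v v = \<Sigma> *\<^sub>v (G\<^sup>T *\<^sub>v x)" .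
  have coeff: "v $ j = s j * (G\<^sup>T *\<^sub>v x) $ j" if "j < l" for j
    using arg_cong[OF JG, of "\<lambda>w. w $ j"] that
    by (simp add: trunc_id_mult_vec[OF vc] diagonal_mult_vec[OF \<Sigma> Gx] s_def)
  have err: "(\<Sum>j<l. (v $ j - u $ j)\<^sup>2) \<le> \<delta>\<^sup>2"
  proof -
    \<comment> \<open>Adding the term with index \<open>l\<close> completes the sum to a full
      squared norm, to which Bessel's inequality applies.\<close>
    have "(\<Sum>j<l. (v $ j - u $ j)\<^sup>2) \<le> (\<Sum>j<l+1. (v $ j - u $ j)\<^sup>2)" by simp
    also have "\<dots> = (U\<^sup>T *\<^sub>v (y - yd)) \<bullet> (U\<^sup>T *\<^sub>v (y - yd))"
      using scalar_prod_diff_sum[OF vc uc] U y yd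
      by (simp add: u_def v_def mult_minus_distrib_mat_vec[of _ "l + 1" n1])
    also have "\<dots> \<le> (y - yd) \<bullet> (y - yd)" using y yd by (intro bessel_inequality[OF U]) auto
    also have "\<dots> = (norm2 (y - yd))\<^sup>2" by (simp add: norm2_square)
    also have "\<dots> \<le> \<delta>\<^sup>2"
      using noise by (intro power_mono) (auto simp: norm2_def scalar_prod_def intro!: sum_nonneg)
    finally show ?thesis .
  qed
  \<comment> \<open>The first two terms are the same for all \<open>b\<close>, so comparing errors
    means comparing the sums in \<open>filtered_error_mono\<close>.\<close>
  have error: "(x - iter_tikhonov i A yd b) \<bullet> (x - iter_tikhonov i A yd b)
      = x \<bullet> x - (G\<^sup>T *\<^sub>v x) \<bullet> (G\<^sup>T *\<^sub>v x)
        + (\<Sum>j<l. (v $ j / s j - (1 - (b / ((s j)\<^sup>2 + b)) ^ i) / s j * u $ j)\<^sup>2)"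
    if b: "0 < b" for b
  proof -
    let ?c = "vec l (\<lambda>j. (1 - (b / ((s j)\<^sup>2 + b)) ^ i) / s j * u $ j)"
    have "iter_tikhonov i A yd b = G *\<^sub>v ?c"
      unfolding s_def u_def by (rule iter_tikhonov_svd[OF U G \<Sigma> pos[unfolded s_def] A yd b])
    moreover have "(G\<^sup>T *\<^sub>v x - ?c) \<bullet> (G\<^sup>T *\<^sub>v x - ?c)
        = (\<Sum>j<l. (v $ j / s j - (1 - (b / ((s j)\<^sup>2 + b)) ^ i) / s j * u $ j)\<^sup>2)"
      using less_imp_neq[OF pos] coeff
      by (subst scalar_prod_diff_sum[OF Gx]) (auto intro!: sum.cong)
    ultimately show ?thesis by (simp add: diff_orthonormal_scalar_prod[OF G x])
  qed
  have "norm2 (x - iter_tikhonov i A yd a) \<le> norm2 (x - iter_tikhonov i A yd a')"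
    if a: "0 < a" "param_eq i \<Sigma> z \<delta> a" "a \<le> a'" for a a'
  proof -
    have "(\<Sum>j<l. (a / ((s j)\<^sup>2 + a)) ^ (2 * i + 1) * (u $ j)\<^sup>2) = \<delta>\<^sup>2"
      using a param by simp
    note filtered_error_mono[OF pos i less_imp_le[OF \<delta>] err a(1,3) this]
    then show ?thesis using a by (simp add: norm2_le_iff error)
  qed
  then show ?thesis using norm_eq ex by blast
qed

theorem proposition7:
  fixes i l n1 n2 :: nat and \<delta> :: real
    and T Tp :: "real mat" and y yd x :: "real vec"
  assumes "1 \<le> i" and "1 \<le> l" and "0 < \<delta>"
    and "T \<in> carrier_mat n1 n2"
    and "y \<in> vec_space.col_space n1 T"
    and "moore_penrose T Tp" and "x = Tp *\<^sub>v y"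
    and "yd \<in> carrier_vec n1" and "yd \<noteq> 0\<^sub>v n1" and "norm2 (y - yd) \<le> \<delta>"
  shows
    "(\<forall>V H W \<Sigma> S. n1 = n2 \<and> arnoldi n1 l T yd V H \<and> is_svd H W \<Sigma> S \<longrightarrow>
       (let Tl = V * H * (first_cols l V)\<^sup>T;
            R = range_proj l V W;
            z = trunc_data l V W yd
        in z \<noteq> 0\<^sub>v (l + 1) \<and> (R * T) *\<^sub>v x = Tl *\<^sub>v x \<and> \<delta> \<le> norm2 (R *\<^sub>v yd) \<longrightarrow>
           norm2 (R *\<^sub>v yd) = norm2 z \<and>
           (\<delta> < norm2 (R *\<^sub>v yd) \<longrightarrow> (\<exists>!a. 0 < a \<and> param_eq i \<Sigma> z \<delta> a)) \<and>
           (\<forall>a. 0 < a \<and> param_eq i \<Sigma> z \<delta> a \<longrightarrow>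
              (\<forall>a' \<ge> a. norm2 (x - iter_tikhonov i Tl yd a)
                        \<le> norm2 (x - iter_tikhonov i Tl yd a'))))) \<and>
     (\<forall>U V B W \<Sigma> S. golub_kahan n1 n2 l T yd U V B \<and> is_svd B W \<Sigma> S \<longrightarrow>
       (let Tl = U * B * V\<^sup>T;
            R = range_proj l U W;
            z = trunc_data l U W yd
        in z \<noteq> 0\<^sub>v (l + 1) \<and> (R * T) *\<^sub>v x = Tl *\<^sub>v x \<and> \<delta> \<le> norm2 (R *\<^sub>v yd) \<longrightarrow>
           norm2 (R *\<^sub>v yd) = norm2 z \<and>
           (\<delta> < norm2 (R *\<^sub>v yd) \<longrightarrow> (\<exists>!a. 0 < a \<and> param_eq i \<Sigma> z \<delta> a)) \<and>
           (\<forall>a. 0 < a \<and> param_eq i \<Sigma> z \<delta> a \<longrightarrow>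
              (\<forall>a' \<ge> a. norm2 (x - iter_tikhonov i Tl yd a)
                        \<le> norm2 (x - iter_tikhonov i Tl yd a')))))"
proof (unfold Let_def, intro conjI[of "All _"] allI impI)
  note choice = projected_discrepancy_choice[OF assms(1,3-8,10)]
  fix V H W \<Sigma> S
  assume "n1 = n2 \<and> arnoldi n1 l T yd V H \<and> is_svd H W \<Sigma> S"
  then have V: "n1 = n2" "V \<in> carrier_mat n1 (l + 1)" "orthonormal_cols V"
    and H: "H \<in> carrier_mat (l + 1) l" "upper_hessenberg H" "\<forall>j<l. H $$ (j + 1, j) \<noteq> 0"
    and svd: "is_svd H W \<Sigma> S"
    by (auto simp: arnoldi_def)
  have P: "first_cols l V \<in> carrier_mat n2 l" using V by (simp add: first_cols_def)
  let ?A = "V * H * (first_cols l V)\<^sup>T" and ?R = "range_proj l V W" and ?z = "trunc_data l V W yd"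
  assume *: "?z \<noteq> 0\<^sub>v (l + 1) \<and> (?R * T) *\<^sub>v x = ?A *\<^sub>v x \<and> \<delta> \<le> norm2 (?R *\<^sub>v yd)"
  show "norm2 (?R *\<^sub>v yd) = norm2 ?z \<and>
      (\<delta> < norm2 (?R *\<^sub>v yd) \<longrightarrow> (\<exists>!a. 0 < a \<and> param_eq i \<Sigma> ?z \<delta> a)) \<and>
      (\<forall>a. 0 < a \<and> param_eq i \<Sigma> ?z \<delta> a \<longrightarrow>
        (\<forall>a' \<ge> a. norm2 (x - iter_tikhonov i ?A yd a) \<le> norm2 (x - iter_tikhonov i ?A yd a')))"
    by (rule choice[OF V(2,3) P orthonormal_first_cols[OF V(2,3)] H svd refl refl refl]) (use * in auto)
next
  note choice = projected_discrepancy_choice[OF assms(1,3-8,10)]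
  fix U V B W \<Sigma> S
  assume "golub_kahan n1 n2 l T yd U V B \<and> is_svd B W \<Sigma> S"
  then have UV: "U \<in> carrier_mat n1 (l + 1)" "orthonormal_cols U"
      "V \<in> carrier_mat n2 l" "orthonormal_cols V"
    \<comment> \<open>Lower bidiagonal matrices are upper Hessenberg, and their subdiagonal is
      nonzero here, so the positivity argument from the Arnoldi case carries over.\<close>
    and B: "B \<in> carrier_mat (l + 1) l" "upper_hessenberg B" "\<forall>j<l. B $$ (j + 1, j) \<noteq> 0"
    and svd: "is_svd B W \<Sigma> S"
    by (auto simp: golub_kahan_def lower_bidiagonal_imp_upper_hessenberg)
  let ?A = "U * B * V\<^sup>T" and ?R = "range_proj l U W" and ?z = "trunc_data l U W yd"
  assume *: "?z \<noteq> 0\<^sub>v (l + 1) \<and> (?R * T) *\<^sub>v x = ?A *\<^sub>v x \<and> \<delta> \<le> norm2 (?R *\<^sub>v yd)"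
  show "norm2 (?R *\<^sub>v yd) = norm2 ?z \<and>
      (\<delta> < norm2 (?R *\<^sub>v yd) \<longrightarrow> (\<exists>!a. 0 < a \<and> param_eq i \<Sigma> ?z \<delta> a)) \<and>
      (\<forall>a. 0 < a \<and> param_eq i \<Sigma> ?z \<delta> a \<longrightarrow>
        (\<forall>a' \<ge> a. norm2 (x - iter_tikhonov i ?A yd a) \<le> norm2 (x - iter_tikhonov i ?A yd a')))"
    by (rule choice[OF UV B svd refl refl refl]) (use * in auto)
qed

end
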